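(* Let $f:\mathbb{R}^n\to\mathbb{R}$ be a convex, twice continuously differentiable function with a minimizer $x^*$, let $m,M,L>0$, and put $\delta=\frac{2}{3}\frac{m}{M+2L}$. Suppose that $\nabla^2 f(x^* )\succeq mI$, that $\|\nabla^2 f(x)-\nabla^2 f(y)\|\le M\|x-y\|$ for all $x,y\in B(x^*,\delta)$, and that $\|\nabla f(x)-\nabla f(y)\|\le L\|x-y\|$ for all $x,y\in\mathbb{R}^n$. Then for any starting point $x_0\in B(x^*,\delta)$ the sequence $\{x_s\}_{s=0}^\infty$ generated by the regularized Newton's method $$x_{s+1}=x_s-\left[\nabla^2 f(x_s)+\|\nabla f(x_s)\|I\right]^{-1}\nabla f(x_s)$$ belongs to $B(x^*,\delta)$, and with $\Delta_s=\|x_s-x^*\|$ the following bound holds: $$\Delta_{s+1}=\|x_{s+1}-x^*\|\le\frac{M+2L}{2}\cdot\frac{1}{m-(M+2L)\Delta_s}\,\Delta_s^2,\qquad s\ge 1.$$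
   Context: $\|\cdot\|$ is the Euclidean norm (and the induced operator norm for matrices), $I$ is the identity matrix in $\mathbb{R}^{n\times n}$, $A\succeq B$ means that $A-B$ is positive semidefinite, and $B(x^*,\delta)=\{x\in\mathbb{R}^n:\|x-x^*\|\le\delta\}$. *)

theory Defs
  imports "HOL-Analysis.Analysis"
begin

definition gradient :: "(real ^ 'n \<Rightarrow> real) \<Rightarrow> real ^ 'n \<Rightarrow> real ^ 'n" where
  "gradient f x = (THE g. GDERIV f x :> g)"

lemma gradient_eq:
  assumes "GDERIV f x :> g"
  shows "gradient f x = g"
  unfolding gradient_def
proof (rule the_equality[where P = "\<lambda>g. GDERIV f x :> g", OF assms])
  fix D
  assume "GDERIV f x :> D"
  with assms have "(\<lambda>h. h \<bullet> D) = (\<lambda>h. h \<bullet> g)"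
    unfolding gderiv_def by (blast intro: has_derivative_unique)
  then show "D = g"
    by (metis vector_eq_ldot)
qed

lemma differentiable_iff_gderiv: "f differentiable (at x) \<longleftrightarrow> (GDERIV f x :> gradient f x)"
proof
  assume "f differentiable (at x)"
  then obtain D where D: "(f has_derivative D) (at x)"
    by (auto simp: differentiable_def)
  interpret bounded_linear D
    using D by (rule has_derivative_bounded_linear)
  have "D = (\<lambda>h. h \<bullet> adjoint D 1)"
    using adjoint_works[OF linear_axioms, of _ 1] by (simp add: fun_eq_iff)
  with D have "GDERIV f x :> adjoint D 1"
    by (simp add: gderiv_def)
  then show "GDERIV f x :> gradient f x"
    by (metis gradient_eq)
qed (auto simp: gderiv_def differentiable_def)

definition hessian :: "(real ^ 'n \<Rightarrow> real) \<Rightarrow> real ^ 'n \<Rightarrow> real ^ 'n ^ 'n" where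
  "hessian f x = jacobian (gradient f) (at x)"

definition twice_continuously_differentiable :: "(real ^ 'n \<Rightarrow> real) \<Rightarrow> bool" where
  "twice_continuously_differentiable f \<longleftrightarrow>
     (\<forall>x. f differentiable (at x)) \<and>
     (\<forall>x. gradient f differentiable (at x)) \<and>
     continuous_on UNIV (hessian f)"

(* The library's norm on matrices is the Frobenius norm, not the induced operator norm. *)
definition op_norm :: "real ^ 'n ^ 'n \<Rightarrow> real" where
  "op_norm A = onorm (\<lambda>v. A *v v)"

definition positive_semidefinite :: "real ^ 'n ^ 'n \<Rightarrow> bool" where
  "positive_semidefinite A \<longleftrightarrow> transpose A = A \<and> (\<forall>v. 0 \<le> v \<bullet> (A *v v))"

definition loewner_ge :: "real ^ 'n ^ 'n \<Rightarrow> real ^ 'n ^ 'n \<Rightarrow> bool"  (infix "\<succeq>" 50) where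
  "A \<succeq> B \<longleftrightarrow> positive_semidefinite (A - B)"

definition regularized_hessian :: "(real ^ 'n \<Rightarrow> real) \<Rightarrow> real ^ 'n \<Rightarrow> real ^ 'n ^ 'n" where
  "regularized_hessian f x = hessian f x + norm (gradient f x) *\<^sub>R mat 1"

end

theory Submission
  imports Defs
begin

text \<open>
  Write \<open>A\<close> for the regularized Hessian at the current iterate \<open>x\<close>, \<open>e = x - xstar\<close> for the error
  before the step and \<open>w\<close> for the error after it. Multiplying the Newton update by \<open>A\<close> gives
  \<open>A w = (H e - g) + \<parallel>g\<parallel> e\<close>, where \<open>H\<close> and \<open>g\<close> are the Hessian and the gradient at \<open>x\<close>. Since the
  gradient vanishes at \<open>xstar\<close>, the first summand is the error of a first-order expansion of the
  gradient, at most \<open>M/2 \<parallel>e\<parallel>\<^sup>2\<close> by the Lipschitz bound on the Hessian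
  (\<open>newton_linearization_error\<close>); the second, the price of the regularization, is at most
  \<open>L \<parallel>e\<parallel>\<^sup>2\<close>, because \<open>\<parallel>g\<parallel> \<le> L \<parallel>e\<parallel>\<close>. Hence regularizing keeps the residual quadratic:
  \<open>\<parallel>A w\<parallel> \<le> (M + 2 L)/2 \<parallel>e\<parallel>\<^sup>2\<close>.

  In the other direction, the Hessian at \<open>xstar\<close> dominates \<open>m I\<close> and moving to \<open>x\<close> costs at most
  \<open>M \<parallel>e\<parallel>\<close>, so \<open>A\<close> is coercive with constant \<open>m - M \<parallel>e\<parallel> \<ge> m - (M + 2 L) \<parallel>e\<parallel>\<close>. Coercivity makes
  \<open>A\<close> invertible and bounds \<open>\<parallel>A w\<parallel>\<close> from below by a multiple of \<open>\<parallel>w\<parallel>\<close>; dividing gives the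
  estimate for one step (\<open>regularized_newton_step\<close>).

  The radius \<open>\<delta>\<close> solves \<open>(M + 2 L)/2 \<cdot> \<delta> = m - (M + 2 L) \<delta>\<close>: it is the largest distance at which
  the one-step bound does not exceed the distance itself. So the iteration never leaves the ball,
  and the estimate applies to every step.
\<close>

section \<open>Coercive matrices\<close>

lemma coercive_norm_lower_bound:
  fixes A :: "real ^ 'n ^ 'n"
  assumes "\<And>v. c * (norm v)\<^sup>2 \<le> v \<bullet> (A *v v)"
  shows "c * norm v \<le> norm (A *v v)"
proof (cases "v = 0")
  case False
  have "(c * norm v) * norm v \<le> v \<bullet> (A *v v)"
    using assms[of v] by (simp add: power2_eq_square mult.assoc)
  also have "\<dots> \<le> norm (A *v v) * norm v"
    using norm_cauchy_schwarz[of v "A *v v"] by (simp add: mult.commute)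
  finally show ?thesis
    using False by simp
qed simp

lemma coercive_imp_invertible:
  fixes A :: "real ^ 'n ^ 'n"
  assumes "c > 0" and "\<And>v. c * (norm v)\<^sup>2 \<le> v \<bullet> (A *v v)"
  shows "invertible A"
proof -
  have "v = 0" if "A *v v = 0" for v
    using coercive_norm_lower_bound[OF assms(2), of v] that \<open>c > 0\<close>
    by (simp add: mult_le_0_iff)
  then show ?thesis
    by (auto simp: invertible_left_inverse matrix_left_invertible_ker)
qed

lemma norm_matrix_vector_le_op_norm: "norm (A *v v) \<le> op_norm A * norm v"
  unfolding op_norm_def by (rule onorm[OF matrix_vector_mul_bounded_linear])

text \<open>Changing a matrix moves its quadratic form by at most the operator norm of the change
  (Cauchy--Schwarz), so the coercivity constant drops by at most that much.\<close>

lemma loewner_ge_perturb_coercive: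
  fixes A B :: "real ^ 'n ^ 'n"
  assumes "A \<succeq> m *\<^sub>R mat 1" and "op_norm (A - B) \<le> r"
  shows "(m - r) * (norm v)\<^sup>2 \<le> v \<bullet> (B *v v)"
proof -
  have "0 \<le> v \<bullet> ((A - m *\<^sub>R mat 1) *v v)"
    using assms(1) by (simp add: loewner_ge_def positive_semidefinite_def)
  then have A: "m * (norm v)\<^sup>2 \<le> v \<bullet> (A *v v)"
    by (simp add: matrix_vector_mult_diff_rdistrib inner_diff_right
        scaleR_matrix_vector_assoc[symmetric] power2_norm_eq_inner)
  have "v \<bullet> ((A - B) *v v) \<le> norm v * norm ((A - B) *v v)"
    by (rule norm_cauchy_schwarz)
  also have "\<dots> \<le> norm v * (r * norm v)"
    using assms(2)
    by (intro mult_left_mono order_trans[OF norm_matrix_vector_le_op_norm] mult_right_mono) auto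
  finally have "v \<bullet> (A *v v) - v \<bullet> (B *v v) \<le> r * (norm v)\<^sup>2"
    by (simp add: matrix_vector_mult_diff_rdistrib inner_diff_right power2_eq_square ac_simps)
  with A show ?thesis
    by (simp add: algebra_simps)
qed

section \<open>First-order behaviour of the gradient\<close>

lemma gradient_minimizer_eq_0:
  assumes "f differentiable (at a)" and "\<forall>y. f a \<le> f y"
  shows "gradient f a = 0"
proof -
  have "(f has_derivative (\<lambda>h. h \<bullet> gradient f a)) (at a)"
    using assms(1) by (simp add: differentiable_iff_gderiv gderiv_def)
  then have "(\<lambda>h. h \<bullet> gradient f a) = (\<lambda>h. 0)"
    by (rule has_derivative_local_min) (simp add: assms(2))
  then show ?thesis
    by (metis inner_eq_zero_iff)
qed

text \<open>Along the segment from \<open>a\<close> to \<open>b\<close>, parametrized by \<open>t\<close>, the curve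
  \<open>t H(b) (b - a) - \<nabla>f(a + t (b - a))\<close> has velocity \<open>(H(b) - H(a + t (b - a))) (b - a)\<close>, of norm at
  most \<open>M \<parallel>b - a\<parallel>\<^sup>2 (1 - t)\<close>, which is the derivative of \<open>M \<parallel>b - a\<parallel>\<^sup>2 (t - t\<^sup>2/2)\<close>. The factor
  \<open>1 - t\<close> is what produces the \<open>1/2\<close> in the bound.\<close>

lemma newton_linearization_error:
  fixes f :: "real ^ 'n \<Rightarrow> real"
  assumes diff: "\<And>y. gradient f differentiable (at y)"
    and "convex S" "a \<in> S" "b \<in> S"
    and lip: "\<And>y z. y \<in> S \<Longrightarrow> z \<in> S \<Longrightarrow>
      op_norm (hessian f y - hessian f z) \<le> M * norm (y - z)"
  shows "norm (hessian f b *v (b - a) - (gradient f b - gradient f a))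
    \<le> M / 2 * (norm (b - a))\<^sup>2"
proof -
  define e where "e = b - a"
  define p where "p t = a + t *\<^sub>R e" for t :: real
  define F where "F t = t *\<^sub>R (hessian f b *v e) - gradient f (p t)" for t
  define \<phi> where "\<phi> t = M * (norm e)\<^sup>2 * (t - t\<^sup>2 / 2)" for t :: real
  have grad: "(gradient f has_derivative (\<lambda>h. hessian f y *v h)) (at y)" for y
    using diff by (simp add: hessian_def jacobian_works)
  have F': "(F has_vector_derivative (hessian f b *v e - hessian f (p t) *v e)) (at t)" for t
  proof -
    have "(p has_derivative (\<lambda>s. s *\<^sub>R e)) (at t)"
      unfolding p_def by (auto intro!: derivative_eq_intros)
    from has_derivative_compose[OF this grad]
    have "((\<lambda>t. gradient f (p t)) has_vector_derivative hessian f (p t) *v e) (at t)"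
      by (simp add: has_vector_derivative_def matrix_vector_mult_scaleR)
    then show ?thesis
      unfolding F_def by (auto intro!: derivative_eq_intros)
  qed
  have \<phi>': "(\<phi> has_vector_derivative M * (norm e)\<^sup>2 * (1 - t)) (at t)" for t
    unfolding \<phi>_def has_real_derivative_iff_has_vector_derivative[symmetric]
    by (auto intro!: derivative_eq_intros)
  have bound: "norm (hessian f b *v e - hessian f (p t) *v e) \<le> M * (norm e)\<^sup>2 * (1 - t)"
    if t: "0 < t" "t < 1" for t
  proof -
    have "p t = (1 - t) *\<^sub>R a + t *\<^sub>R b"
      by (simp add: p_def e_def algebra_simps)
    then have "p t \<in> S"
      using t assms(2-4) by (simp add: convex_alt)
    have "b - p t = (1 - t) *\<^sub>R e"
      by (simp add: p_def e_def algebra_simps)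
    then have dist: "norm (b - p t) = (1 - t) * norm e"
      using t by simp
    have "norm ((hessian f b - hessian f (p t)) *v e)
        \<le> op_norm (hessian f b - hessian f (p t)) * norm e"
      by (rule norm_matrix_vector_le_op_norm)
    also have "\<dots> \<le> (M * ((1 - t) * norm e)) * norm e"
      using lip[OF \<open>b \<in> S\<close> \<open>p t \<in> S\<close>] by (intro mult_right_mono) (simp_all add: dist)
    finally show ?thesis
      by (simp add: matrix_vector_mult_diff_rdistrib power2_eq_square ac_simps)
  qed
  have "norm (F 1 - F 0) \<le> \<phi> 1 - \<phi> 0"
  proof (rule differentiable_bound_general)
    show "continuous_on {0..1} F" "continuous_on {0..1} \<phi>"
      by (auto intro!: continuous_at_imp_continuous_on
          has_vector_derivative_continuous[OF F'] has_vector_derivative_continuous[OF \<phi>'])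
  qed (use F' \<phi>' bound in auto)
  then show ?thesis
    by (simp add: F_def p_def \<phi>_def e_def algebra_simps)
qed

section \<open>The regularized Newton step\<close>

lemma mult_matrix_inv_right:
  fixes A :: "'a::semiring_1 ^ 'n ^ 'm"
  assumes "invertible A"
  shows "A ** matrix_inv A = mat 1"
  using someI_ex[OF assms[unfolded invertible_def]] by (simp add: matrix_inv_def)

lemma regularized_newton_step_residual:
  fixes f :: "real ^ 'n \<Rightarrow> real"
  assumes "invertible (regularized_hessian f x)"
    and "x' = x - matrix_inv (regularized_hessian f x) *v gradient f x"
  shows "regularized_hessian f x *v (x' - a)
    = (hessian f x *v (x - a) - gradient f x) + norm (gradient f x) *\<^sub>R (x - a)"
proof -
  let ?A = "regularized_hessian f x"
  have "?A *v (matrix_inv ?A *v gradient f x) = gradient f x"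
    using mult_matrix_inv_right[OF assms(1)] by (simp add: matrix_vector_mul_assoc)
  then have "?A *v (x' - a) = ?A *v (x - a) - gradient f x"
    by (simp add: assms(2) matrix_vector_mult_diff_distrib)
  also have "?A *v (x - a) = hessian f x *v (x - a) + norm (gradient f x) *\<^sub>R (x - a)"
    by (simp add: regularized_hessian_def matrix_vector_mult_add_rdistrib
        scaleR_matrix_vector_assoc[symmetric])
  finally show ?thesis
    by simp
qed

lemma regularized_hessian_coercive:
  assumes "hessian f a \<succeq> m *\<^sub>R mat 1" and "op_norm (hessian f a - hessian f x) \<le> r"
  shows "(m - r) * (norm v)\<^sup>2 \<le> v \<bullet> (regularized_hessian f x *v v)"
proof -
  have "(m - r) * (norm v)\<^sup>2 \<le> v \<bullet> (hessian f x *v v)"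
    using assms by (rule loewner_ge_perturb_coercive)
  then show ?thesis
    by (simp add: regularized_hessian_def matrix_vector_mult_add_rdistrib
        scaleR_matrix_vector_assoc[symmetric] inner_add_right add_increasing2)
qed

text \<open>The residual of the step is quadratic in the distance to the critical point \<open>a\<close>, and the
  regularized Hessian is coercive; comparing the two bounds on the residual gives the estimate.\<close>

lemma regularized_newton_step:
  fixes f :: "real ^ 'n \<Rightarrow> real"
  assumes diff: "\<And>y. gradient f differentiable (at y)"
    and crit: "gradient f a = 0"
    and "convex S" "a \<in> S" "x \<in> S"
    and lip: "\<And>y z. y \<in> S \<Longrightarrow> z \<in> S \<Longrightarrow>
      op_norm (hessian f y - hessian f z) \<le> M * norm (y - z)"
    and grad: "norm (gradient f x) \<le> L * norm (x - a)"
    and pos: "hessian f a \<succeq> m *\<^sub>R mat 1"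
    and "L \<ge> 0" and near: "(M + 2 * L) * norm (x - a) < m"
  shows "invertible (regularized_hessian f x)"
    and "x' = x - matrix_inv (regularized_hessian f x) *v gradient f x \<Longrightarrow>
      norm (x' - a) \<le> (M + 2 * L) / 2 * (1 / (m - (M + 2 * L) * norm (x - a)))
        * (norm (x - a))\<^sup>2"
proof -
  let ?A = "regularized_hessian f x" and ?d = "norm (x - a)"
  define c where "c = m - (M + 2 * L) * ?d"
  have "c > 0"
    using near by (simp add: c_def)
  have "op_norm (hessian f a - hessian f x) \<le> M * ?d"
    using lip[OF \<open>a \<in> S\<close> \<open>x \<in> S\<close>] by (simp add: norm_minus_commute)
  also have "\<dots> \<le> (M + 2 * L) * ?d"
    using \<open>L \<ge> 0\<close> by (intro mult_right_mono) auto
  finally have coercive: "c * (norm v)\<^sup>2 \<le> v \<bullet> (?A *v v)" for v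
    unfolding c_def using pos by (intro regularized_hessian_coercive)
  show inv: "invertible ?A"
    using \<open>c > 0\<close> coercive by (rule coercive_imp_invertible)
  assume x': "x' = x - matrix_inv ?A *v gradient f x"
  have "c * norm (x' - a) \<le> norm (?A *v (x' - a))"
    using coercive by (rule coercive_norm_lower_bound)
  also have "\<dots> \<le> norm (hessian f x *v (x - a) - gradient f x) + norm (gradient f x) * ?d"
    unfolding regularized_newton_step_residual[OF inv x'] by (rule norm_triangle_le) simp
  also have "\<dots> \<le> M / 2 * ?d\<^sup>2 + (L * ?d) * ?d"
    using newton_linearization_error[OF diff \<open>convex S\<close> \<open>a \<in> S\<close> \<open>x \<in> S\<close> lip] grad
    by (intro add_mono mult_right_mono) (simp_all add: crit)
  also have "\<dots> = (M + 2 * L) / 2 * ?d\<^sup>2"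
    by (simp add: field_simps power2_eq_square)
  finally have "norm (x' - a) \<le> (M + 2 * L) / 2 * ?d\<^sup>2 / c"
    using \<open>c > 0\<close> by (subst pos_le_divide_eq) (simp_all only: mult.commute)
  then show "norm (x' - a) \<le> (M + 2 * L) / 2 * (1 / (m - (M + 2 * L) * ?d)) * ?d\<^sup>2"
    by (simp add: c_def)
qed

text \<open>At distance \<open>d\<close> with \<open>K d \<le> 2/3 m\<close>, the numerator \<open>K d / 2\<close> of the contraction factor is at
  most \<open>m/3\<close> and its denominator at least \<open>m/3\<close>.\<close>

lemma newton_bound_le_distance:
  fixes K d m :: real
  assumes "m > 0" "d \<ge> 0" "K * d \<le> 2 / 3 * m"
  shows "K / 2 * (1 / (m - K * d)) * d\<^sup>2 \<le> d"
proof -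
  have "K * d / 2 \<le> m - K * d" and "m - K * d > 0"
    using assms by linarith+
  then have "(K * d / 2) / (m - K * d) \<le> 1"
    by (simp add: divide_le_eq)
  then have "(K * d / 2) / (m - K * d) * d \<le> 1 * d"
    using \<open>d \<ge> 0\<close> by (rule mult_right_mono)
  then show ?thesis
    by (simp add: power2_eq_square)
qed

theorem theorem7p1:
  fixes f :: "real ^ 'n \<Rightarrow> real"
    and xstar :: "real ^ 'n"
    and x :: "nat \<Rightarrow> real ^ 'n"
    and m M L \<delta> :: real
  assumes "convex_on UNIV f"
    and "twice_continuously_differentiable f"
    and "\<forall>y. f xstar \<le> f y"
    and "m > 0" and "M > 0" and "L > 0"
    and "\<delta> = 2 / 3 * (m / (M + 2 * L))"
    and "hessian f xstar \<succeq> m *\<^sub>R mat 1"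
    and "\<forall>y \<in> cball xstar \<delta>. \<forall>z \<in> cball xstar \<delta>.
           op_norm (hessian f y - hessian f z) \<le> M * norm (y - z)"
    and "\<forall>y z. norm (gradient f y - gradient f z) \<le> L * norm (y - z)"
    and "x 0 \<in> cball xstar \<delta>"
    and "\<forall>s. x (Suc s) = x s - matrix_inv (regularized_hessian f (x s)) *v gradient f (x s)"
  shows "(\<forall>s. invertible (regularized_hessian f (x s))) \<and>
         (\<forall>s. x s \<in> cball xstar \<delta>) \<and>
         (\<forall>s\<ge>1. norm (x (Suc s) - xstar)
            \<le> (M + 2 * L) / 2 * (1 / (m - (M + 2 * L) * norm (x s - xstar)))
               * (norm (x s - xstar))\<^sup>2)"
proof -
  define K where "K = M + 2 * L"
  have "K > 0"
    using \<open>M > 0\<close> \<open>L > 0\<close> by (simp add: K_def)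
  moreover have \<delta>: "\<delta> = 2 / 3 * (m / K)"
    using assms(7) by (simp add: K_def)
  ultimately have "\<delta> > 0" and K\<delta>: "K * \<delta> = 2 / 3 * m"
    using \<open>m > 0\<close> by simp_all
  have diff: "\<And>y. f differentiable (at y)" "\<And>y. gradient f differentiable (at y)"
    using assms(2) by (auto simp: twice_continuously_differentiable_def)
  have crit: "gradient f xstar = 0"
    using diff(1) assms(3) by (rule gradient_minimizer_eq_0)
  have close: "K * norm (y - xstar) \<le> 2 / 3 * m" if "y \<in> cball xstar \<delta>" for y
  proof -
    have "K * norm (y - xstar) \<le> K * \<delta>"
      using that \<open>K > 0\<close> by (simp add: dist_norm norm_minus_commute)
    then show ?thesis
      by (simp add: K\<delta>)
  qed
  have step: "invertible (regularized_hessian f (x s))"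
    "norm (x (Suc s) - xstar) \<le> (M + 2 * L) / 2 *
      (1 / (m - (M + 2 * L) * norm (x s - xstar))) * (norm (x s - xstar))\<^sup>2"
    if xs: "x s \<in> cball xstar \<delta>" for s
  proof -
    have grad: "norm (gradient f (x s)) \<le> L * norm (x s - xstar)"
      using assms(10) crit by (metis diff_zero)
    have near: "(M + 2 * L) * norm (x s - xstar) < m"
      using close[OF xs] \<open>m > 0\<close> unfolding K_def by linarith
    have centre: "xstar \<in> cball xstar \<delta>"
      using \<open>\<delta> > 0\<close> by simp
    have lip: "op_norm (hessian f y - hessian f z) \<le> M * norm (y - z)"
      if "y \<in> cball xstar \<delta>" "z \<in> cball xstar \<delta>" for y z
      using assms(9) that by blast
    note newton = regularized_newton_step[OF diff(2) crit convex_cball centre xs lip grad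
        assms(8) less_imp_le[OF \<open>L > 0\<close>] near]
    show "invertible (regularized_hessian f (x s))"
      by (rule newton(1))
    show "norm (x (Suc s) - xstar) \<le> (M + 2 * L) / 2 *
        (1 / (m - (M + 2 * L) * norm (x s - xstar))) * (norm (x s - xstar))\<^sup>2"
      by (rule newton(2)) (simp_all only: assms(12)[rule_format])
  qed
  have "x s \<in> cball xstar \<delta>" for s
  proof (induction s)
    case (Suc s)
    have "norm (x (Suc s) - xstar) \<le> norm (x s - xstar)"
      using step(2)[OF Suc] newton_bound_le_distance[OF \<open>m > 0\<close> norm_ge_zero close[OF Suc]]
      unfolding K_def by (rule order_trans)
    with Suc show ?case
      by (simp add: dist_norm norm_minus_commute)
  qed (rule assms(11))
  with step show ?thesis
    by blast
qed

end
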